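(* Let $\mathbb{F}$ be a field and $n$ a positive integer. For any $A,B\in M_n$, \begin{align*} S_4(A+B)={}&S_4(A)+S_4(B)-S_1(A^3B)-S_1(A^2B^2)-S_1(AB^3)\\ &+S_1(A^2B)S_1(A)+S_1(A^2B)S_1(B)+S_1(AB^2)S_1(A)+S_1(AB^2)S_1(B)\\ &-S_1(AB)S_1(A)S_1(B)+S_3(A)S_1(B)+S_3(B)S_1(A)+S_2(A)S_2(B)\\ &-S_2(A)S_1(AB)-S_2(B)S_1(AB)+S_2(AB). \end{align*}
   Context: $M_n$ denotes the set of $n\times n$ matrices over an arbitrary field $\mathbb{F}$. For $C\in M_n$, $S_k(C)$ is the $k$-th elementary symmetric function of $C$, defined by $\det(tI-C)=t^n-S_1(C)t^{n-1}+\cdots+(-1)^nS_n(C)$; equivalently $S_k(C)=\sum_{|\alpha|=k}\det(C(\alpha,\alpha))$, the sum over index sets $\alpha\subseteq\{1,\dots,n\}$ of size $k$, where $C(\alpha,\alpha)$ is the submatrix of $C$ in the rows and columns indexed by $\alpha$. In particular $S_1$ is the trace. By convention $S_k(C)=0$ for $k>n$. *)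

theory Defs
  imports "Jordan_Normal_Form.Char_Poly"
begin

(* The guard matters: truncated subtraction would otherwise give a nonzero value for k > n,
   where S k C is 0 by convention. *)
definition S :: "nat \<Rightarrow> 'a :: field mat \<Rightarrow> 'a" where
  "S k C = (if k \<le> dim_row C then (-1) ^ k * coeff (char_poly C) (dim_row C - k) else 0)"

lemma char_poly_eq_sum_S:
  fixes C :: "'a :: field mat"
  assumes "C \<in> carrier_mat n n"
  shows "char_poly C = (\<Sum>k\<le>n. monom ((-1) ^ k * S k C) (n - k))"
proof -
  have dim: "dim_row C = n" and deg: "degree (char_poly C) = n"
    using assms degree_monic_char_poly[OF assms] by auto
  have "char_poly C = (\<Sum>i\<le>n. monom (coeff (char_poly C) i) i)"
    using poly_as_sum_of_monoms[of "char_poly C"] deg by simp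
  also have "\<dots> = (\<Sum>k\<le>n. monom (coeff (char_poly C) (n - k)) (n - k))"
    by (rule sum.reindex_bij_witness[of _ "\<lambda>k. n - k" "\<lambda>k. n - k"]) auto
  also have "\<dots> = (\<Sum>k\<le>n. monom ((-1) ^ k * S k C) (n - k))"
    by (intro sum.cong refl) (simp add: S_def dim mult.assoc[symmetric] power_mult_distrib[symmetric])
  finally show ?thesis .
qed

end

theory Submission
  imports Defs "HOL-Number_Theory.Cong"
begin

text \<open>
  The numbers \<open>S k C\<close> are the coefficients of \<open>det (1 - t C) = 1 - S 1 C t + S 2 C t^2 - \<dots>\<close>, so
  the theorem compares the coefficients of \<open>t^4\<close> on both sides of an identity between such
  determinants. The starting point is \<open>(1 - t A)(1 - t B) = 1 - t (A + B) + t^2 A B\<close>: the right-hand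
  side would be what is wanted but for the last term, which is removed by inserting a factor between
  \<open>1 - t A\<close> and \<open>1 - t B\<close>. Over power series that factor is
  \<open>1 - t^2 (1 - t A)^(-1) A B (1 - t B)^(-1)\<close>, that is, one minus the sum of all words
  \<open>t^(i+j) A^i B^j\<close> with \<open>i, j \<ge> 1\<close>.

  Modulo \<open>t^5\<close> only the words of length at most 4 survive. Writing \<open>C2\<close>, \<open>C3\<close>, \<open>C4\<close> for the sums
  of the words of length 2, 3, 4, any product of two of the terms \<open>t^2 C2\<close>, \<open>t^3 C3\<close>, \<open>t^4 C4\<close> that
  mixes different lengths vanishes modulo \<open>t^5\<close>, so the inserted factor splits further and
  \<open>1 - t (A + B) = (1 - t A)(1 - t^2 C2)(1 - t^3 C3)(1 - t^4 C4)(1 - t B)\<close> modulo \<open>t^5\<close>.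
  Taking determinants (\<open>det_truncated_factorization\<close>) and reading off each factor by
  \<open>coeff_det_one_minus_graded\<close> gives \<open>S 4 (A + B)\<close> in terms of \<open>A\<close>, \<open>B\<close> and \<open>C2\<close>, \<open>C3\<close>, \<open>C4\<close>;
  the additivity of \<open>S 1\<close> splits \<open>S 1 C3\<close> and \<open>S 1 C4\<close> into single words. No division by an
  integer takes place, hence the characteristic of the field does not matter. The term \<open>S 2 (A B)\<close>
  is the coefficient of \<open>t^4\<close> in \<open>det (1 - t^2 A B)\<close>.
\<close>

section \<open>The determinant of one minus a homogeneous matrix\<close>

lemma S_0:
  fixes C :: "'a :: field mat"
  assumes "C \<in> carrier_mat n n"
  shows "S 0 C = 1"
  using degree_monic_char_poly[OF assms] assms by (simp add: S_def)

lemma S_eq_0: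
  fixes C :: "'a :: field mat"
  assumes "C \<in> carrier_mat n n" and "n < k"
  shows "S k C = 0"
  using assms by (simp add: S_def)

text \<open>
  The matrix \<open>t^k W\<close> over the polynomials in \<open>t\<close>. Carrying the power of \<open>t\<close> along with the matrix
  makes the degree of each word visible, so that truncation modulo a power of \<open>t\<close> is automatic.
\<close>
definition graded :: "nat \<Rightarrow> 'a :: field mat \<Rightarrow> 'a poly mat" where
  "graded k W = map_mat (\<lambda>a. monom a k) W"

lemma graded_carrier [simp]:
  "graded k W \<in> carrier_mat n m \<longleftrightarrow> W \<in> carrier_mat n m"
  by (simp add: graded_def)

lemma index_graded [simp]:
  "i < dim_row W \<Longrightarrow> j < dim_col W \<Longrightarrow> graded k W $$ (i, j) = monom (W $$ (i, j)) k"
  "dim_row (graded k W) = dim_row W" "dim_col (graded k W) = dim_col W"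
  by (simp_all add: graded_def)

lemma graded_add:
  assumes "V \<in> carrier_mat n m" "W \<in> carrier_mat n m"
  shows "graded k (V + W) = graded k V + graded k W"
  using assms by (intro eq_matI) (auto simp: add_monom)

lemma graded_mult:
  assumes "V \<in> carrier_mat n m" "W \<in> carrier_mat m l"
  shows "graded i V * graded j W = graded (i + j) (V * W)"
proof (rule eq_matI)
  have monom_sum: "monom (sum f I) k = (\<Sum>x\<in>I. monom (f x) k)" for f :: "nat \<Rightarrow> 'a" and I k
    by (induction I rule: infinite_finite_induct) (simp_all flip: add_monom)
  fix r c assume "r < dim_row (graded (i + j) (V * W))" "c < dim_col (graded (i + j) (V * W))"
  then show "(graded i V * graded j W) $$ (r, c) = graded (i + j) (V * W) $$ (r, c)"
    using assms by (simp add: scalar_prod_def monom_sum mult_monom)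
qed (use assms in auto)

text \<open>
  This is the characteristic polynomial of \<open>W\<close> read backwards, at \<open>q = t^k\<close>. Let \<open>c\<close> be the
  characteristic polynomial, in a further variable \<open>x\<close>, of the matrix \<open>q W\<close>; then
  \<open>det (1 - q W) = c(1)\<close>. Substituting \<open>q x\<close> for \<open>x\<close> allows \<open>q\<close> to be pulled out of every row:
  \<open>c(q x) = det (q x - q W) = q^n det (x - W)\<close>. Comparing coefficients of \<open>x^(n-j)\<close> and cancelling
  \<open>q^(n-j)\<close>, which is legitimate since polynomials form a domain, yields the coefficients of \<open>c\<close>.
\<close>
lemma det_one_minus_graded:
  fixes W :: "'a :: field mat"
  assumes W: "W \<in> carrier_mat n n"
  shows "det (1\<^sub>m n - graded k W) = (\<Sum>j\<le>n. monom ((-1) ^ j * S j W) (k * j))"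
proof -
  define q :: "'a poly" where "q = monom 1 k"
  have q0: "q \<noteq> 0" by (simp add: q_def)
  define L where "L = map_mat (\<lambda>a. [:a:]) W"
  have L: "L \<in> carrier_mat n n" and G: "graded k W \<in> carrier_mat n n"
    using W by (simp_all add: L_def)
  interpret const: comm_ring_hom "\<lambda>a :: 'a. [:a:]"
    by unfold_locales (simp_all add: one_pCons)
  let ?c = "char_poly (graded k W)"
  have cpm: "char_poly_matrix (graded k W) \<in> carrier_mat n n"
    "char_poly_matrix L \<in> carrier_mat n n" using G L by auto
  have "map_mat (\<lambda>p. p \<circ>\<^sub>p [:0, q:]) (char_poly_matrix (graded k W)) = [:q:] \<cdot>\<^sub>m char_poly_matrix L"
    using W by (intro eq_matI)
      (auto simp: char_poly_matrix_def L_def q_def pcompose_pCons smult_monom minus_monom)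
  then have "?c \<circ>\<^sub>p [:0, q:] = det ([:q:] \<cdot>\<^sub>m char_poly_matrix L)"
    unfolding char_poly_def by (metis comm_ring_hom.hom_det[OF pcompose_hom.comm_ring_hom_axioms])
  also have "\<dots> = [:q:] ^ n * char_poly L"
    using cpm by (simp add: char_poly_def)
  also have "char_poly L = map_poly (\<lambda>a. [:a:]) (char_poly W)"
    unfolding L_def by (rule const.char_poly_hom[OF W])
  finally have eq: "?c \<circ>\<^sub>p [:0, q:] = Polynomial.smult (q ^ n) (map_poly (\<lambda>a. [:a:]) (char_poly W))"
    by (simp add: poly_const_pow)
  have coeff_c: "coeff ?c (n - j) = monom ((-1) ^ j * S j W) (k * j)" if "j \<le> n" for j
  proof -
    have "q ^ (n - j) * coeff ?c (n - j) = q ^ n * [:coeff (char_poly W) (n - j):]"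
      using arg_cong[OF eq, of "\<lambda>p. coeff p (n - j)"]
      by (simp add: coeff_pcompose_linear coeff_map_poly)
    also have "\<dots> = q ^ (n - j) * (q ^ j * [:coeff (char_poly W) (n - j):])"
      using that by (simp add: power_add[symmetric] mult.assoc[symmetric])
    finally have "coeff ?c (n - j) = q ^ j * [:coeff (char_poly W) (n - j):]"
      using mult_left_cancel[OF power_not_zero[OF q0]] by blast
    also have "[:coeff (char_poly W) (n - j):] = [:(-1) ^ j * S j W:]"
      using that W by (simp add: S_def mult.assoc[symmetric] power_mult_distrib[symmetric])
    also have "q ^ j * [:(-1) ^ j * S j W:] = monom ((-1) ^ j * S j W) (k * j)"
      by (simp add: q_def monom_power smult_monom mult.commute)
    finally show ?thesis .
  qed
  have "det (1\<^sub>m n - graded k W) = poly ?c 1"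
    unfolding char_poly_def
    by (rule poly_det_cong[OF _ cpm(1), symmetric])
      (use W in \<open>auto simp: char_poly_matrix_def\<close>)
  also have "\<dots> = (\<Sum>i\<le>n. coeff ?c i)"
    using degree_monic_char_poly[OF G] by (simp add: poly_altdef)
  also have "\<dots> = (\<Sum>j\<le>n. coeff ?c (n - j))"
    by (rule sum.reindex_bij_witness[of _ "\<lambda>k. n - k" "\<lambda>k. n - k"]) auto
  also have "\<dots> = (\<Sum>j\<le>n. monom ((-1) ^ j * S j W) (k * j))"
    by (intro sum.cong) (simp_all add: coeff_c)
  finally show ?thesis .
qed

lemma coeff_det_one_minus_graded:
  fixes W :: "'a :: field mat"
  assumes W: "W \<in> carrier_mat n n" and "0 < k"
  shows "coeff (det (1\<^sub>m n - graded k W)) m =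
    (if k dvd m then (-1) ^ (m div k) * S (m div k) W else 0)"
proof -
  have *: "(k * j = m) = (k dvd m \<and> j = m div k)" for j
    using \<open>0 < k\<close> by auto
  show ?thesis
  proof (cases "k dvd m")
    case True
    then have "coeff (det (1\<^sub>m n - graded k W)) m =
        (\<Sum>j\<le>n. if j = m div k then (-1) ^ j * S j W else 0)"
      by (simp add: det_one_minus_graded[OF W] coeff_sum *)
    also have "\<dots> = (if m div k \<le> n then (-1) ^ (m div k) * S (m div k) W else 0)"
      by (simp add: sum.delta)
    finally show ?thesis
      using True S_eq_0[OF W, of "m div k"] by (simp add: not_le)
  next
    case False
    then show ?thesis by (simp add: det_one_minus_graded[OF W] coeff_sum *)
  qed
qed

section \<open>Determinants modulo a power of the indeterminate\<close>

lemma cong_monom_iff: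
  fixes p q :: "'a :: field poly"
  shows "[p = q] (mod monom 1 d) \<longleftrightarrow> (\<forall>m<d. coeff p m = coeff q m)"
  by (simp add: cong_iff_dvd_diff monom_1_dvd_iff')

lemma det_cong:
  fixes M N :: "'a :: field poly mat"
  assumes "M \<in> carrier_mat n n" and "N \<in> carrier_mat n n"
    and "\<And>i j. i < n \<Longrightarrow> j < n \<Longrightarrow> [M $$ (i, j) = N $$ (i, j)] (mod q)"
  shows "[det M = det N] (mod q)"
  unfolding det_def'[OF assms(1)] det_def'[OF assms(2)]
  by (intro cong_sum cong_mult cong_prod cong_refl assms(3)) (auto simp: permutes_in_image)

lemma one_minus_mult_mat:
  fixes M X :: "'a :: comm_ring_1 mat"
  assumes "M \<in> carrier_mat n n" and "X \<in> carrier_mat n n"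
  shows "(1\<^sub>m n - M) * X = X - M * X"
  using minus_mult_distrib_mat[OF one_carrier_mat assms] assms by simp

lemma mult_one_minus_mat:
  fixes M X :: "'a :: comm_ring_1 mat"
  assumes "M \<in> carrier_mat n n" and "X \<in> carrier_mat n n"
  shows "X * (1\<^sub>m n - M) = X - X * M"
  using mult_minus_distrib_mat[OF assms(2) one_carrier_mat assms(1)] assms by simp

text \<open>
  The product \<open>(1 - M)(1 - N)\<close> differs from \<open>1 - (M + N)\<close> by \<open>M N\<close> alone. This splits off one degree
  after the other from a sum of words.
\<close>
lemma det_one_minus_add_cong:
  fixes M N :: "'a :: field poly mat"
  assumes M: "M \<in> carrier_mat n n" and N: "N \<in> carrier_mat n n"
    and MN: "\<And>i j. i < n \<Longrightarrow> j < n \<Longrightarrow> q dvd (M * N) $$ (i, j)"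
  shows "[det (1\<^sub>m n - (M + N)) = det (1\<^sub>m n - M) * det (1\<^sub>m n - N)] (mod q)"
proof -
  have "(1\<^sub>m n - M) * (1\<^sub>m n - N) = 1\<^sub>m n - M - (N - M * N)"
    using M N by (simp add: one_minus_mult_mat[of _ n] mult_one_minus_mat[of _ n] minus_carrier_mat)
  moreover have "[det (1\<^sub>m n - (M + N)) = det (1\<^sub>m n - M - (N - M * N))] (mod q)"
  proof (rule det_cong)
    fix i j assume ij: "i < n" "j < n"
    then show "[(1\<^sub>m n - (M + N)) $$ (i, j) = (1\<^sub>m n - M - (N - M * N)) $$ (i, j)] (mod q)"
      using M N MN[OF ij] by (simp add: cong_iff_dvd_diff algebra_simps del: index_mult_mat(1))
  qed (use M N in auto)
  ultimately show ?thesis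
    using M N by (metis det_mult minus_carrier_mat)
qed

text \<open>
  Linearity of the trace, seen from \<open>(1 - t V)(1 - t W) = 1 - t (V + W)\<close> modulo \<open>t^2\<close>; this
  avoids expressing \<open>S 1\<close> through diagonal entries.
\<close>
lemma S_1_add:
  fixes V W :: "'a :: field mat"
  assumes "V \<in> carrier_mat n n" and "W \<in> carrier_mat n n"
  shows "S 1 (V + W) = S 1 V + S 1 W"
proof -
  have "[det (1\<^sub>m n - (graded 1 V + graded 1 W))
      = det (1\<^sub>m n - graded 1 V) * det (1\<^sub>m n - graded 1 W)] (mod monom 1 2)"
    using assms by (intro det_one_minus_add_cong)
      (auto simp: graded_mult monom_1_dvd_iff' simp del: index_mult_mat(1))
  then have "coeff (det (1\<^sub>m n - graded 1 (V + W))) 1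
      = coeff (det (1\<^sub>m n - graded 1 V) * det (1\<^sub>m n - graded 1 W)) 1"
    using assms by (simp add: cong_monom_iff graded_add)
  then show ?thesis
    using assms by (simp add: coeff_det_one_minus_graded[of _ n] coeff_mult S_0[of _ n])
      (metis add.commute minus_add_distrib neg_equal_iff_equal uminus_add_conv_diff)
qed

section \<open>The factorization modulo the fifth power and the theorem\<close>

text \<open>
  With \<open>P = t A\<close>, \<open>Q = t B\<close> and \<open>N\<close> the sum of the words, \<open>(1 - P)(1 - N)(1 - Q)\<close> equals
  \<open>1 - (P + Q)\<close> plus the error \<open>(P Q + P N + N Q) - (N + P N Q)\<close>. In the error, \<open>P N\<close>
  lists the words with at least two letters \<open>A\<close> and \<open>N Q\<close> those with at least two letters \<open>B\<close>, so
  a word with at least two letters of each kind is listed twice; \<open>P N Q\<close> accounts for the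
  repetition. The hypotheses on \<open>C3\<close> and \<open>C4\<close> are exactly this cancellation in degrees 3 and 4. In
  degree 3 there is no repetition, and in degree 4 the repeated word is \<open>A C2 B\<close>; moving it to the
  left avoids subtraction of matrices.
\<close>
lemma det_truncated_factorization:
  fixes A B :: "'a :: field mat"
  assumes A: "A \<in> carrier_mat n n" and B: "B \<in> carrier_mat n n"
    and C2: "C2 = A * B"
    and C3: "C3 = A * C2 + C2 * B"
    and C4: "C4 \<in> carrier_mat n n" "C4 + A * C2 * B = A * C3 + C3 * B"
  shows "[det (1\<^sub>m n - graded 1 (A + B)) =
      det (1\<^sub>m n - graded 1 A) *
      (det (1\<^sub>m n - graded 2 C2) * (det (1\<^sub>m n - graded 3 C3) * det (1\<^sub>m n - graded 4 C4))) *
      det (1\<^sub>m n - graded 1 B)] (mod monom 1 5)"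
proof -
  have carr: "C2 \<in> carrier_mat n n" "C3 \<in> carrier_mat n n"
    using A B by (simp_all add: C2 C3)
  define P Q N where "P = graded 1 A" and "Q = graded 1 B"
    and "N = graded 2 C2 + (graded 3 C3 + graded 4 C4)"
  have PQN: "P \<in> carrier_mat n n" "Q \<in> carrier_mat n n" "N \<in> carrier_mat n n"
    using A B carr C4 by (simp_all add: P_def Q_def N_def)
  define E where "E = (P * Q + P * N + N * Q) - (N + P * N * Q)"
  have E: "E \<in> carrier_mat n n"
    using PQN by (simp add: E_def minus_carrier_mat)
  have expand: "(1\<^sub>m n - P) * (1\<^sub>m n - N) * (1\<^sub>m n - Q) = (1\<^sub>m n - (P + Q)) + E"
    unfolding E_def
    using PQN by (simp add: one_minus_mult_mat[of _ n] mult_one_minus_mat[of _ n]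
        minus_mult_distrib_mat[of _ n n _ _ n] mult_minus_distrib_mat[of _ n n _ n] minus_carrier_mat)
      (intro eq_matI; simp add: algebra_simps del: index_mult_mat(1))
  have E_dvd: "monom 1 5 dvd E $$ (i, j)"
    if ij: "i < n" "j < n" for i j
  proof -
    have "(C4 + A * C2 * B) $$ (i, j) = (A * C3 + C3 * B) $$ (i, j)"
      "C3 $$ (i, j) = (A * C2 + C2 * B) $$ (i, j)"
      using C4 by (simp_all add: C3)
    then have "C4 $$ (i, j) = (A * C3) $$ (i, j) + (C3 * B) $$ (i, j) - (A * (C2 * B)) $$ (i, j)"
      "C3 $$ (i, j) = (A * C2) $$ (i, j) + (C2 * B) $$ (i, j)"
      using A B C4 carr ij by (simp_all add: algebra_simps del: index_mult_mat(1))
    then show ?thesis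
      using A B C4 carr ij
      by (simp add: E_def P_def Q_def N_def graded_mult[of _ n n _ n] mult_add_distrib_mat[of _ n n _ n]
        add_mult_distrib_mat[of _ n n _ _ n] monom_1_dvd_iff' C2[symmetric] del: index_mult_mat(1))
  qed
  have "[det (1\<^sub>m n - (P + Q)) = det ((1\<^sub>m n - P) * (1\<^sub>m n - N) * (1\<^sub>m n - Q))] (mod monom 1 5)"
    unfolding expand using PQN E E_dvd
    by (intro det_cong) (auto simp: cong_iff_dvd_diff)
  also have "det ((1\<^sub>m n - P) * (1\<^sub>m n - N) * (1\<^sub>m n - Q))
      = det (1\<^sub>m n - P) * det (1\<^sub>m n - N) * det (1\<^sub>m n - Q)"
    using PQN by (metis det_mult minus_carrier_mat mult_carrier_mat)
  also have "[\<dots> = det (1\<^sub>m n - P) * (det (1\<^sub>m n - graded 2 C2) *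
      (det (1\<^sub>m n - graded 3 C3) * det (1\<^sub>m n - graded 4 C4))) * det (1\<^sub>m n - Q)] (mod monom 1 5)"
  proof (intro cong_mult cong_refl)
    have "[det (1\<^sub>m n - N) = det (1\<^sub>m n - graded 2 C2) * det (1\<^sub>m n - (graded 3 C3 + graded 4 C4))]
        (mod monom 1 5)"
      unfolding N_def using carr C4
      by (intro det_one_minus_add_cong)
        (auto simp: graded_mult[of _ n n _ n] mult_add_distrib_mat[of _ n n _ n] monom_1_dvd_iff'
          simp del: index_mult_mat(1))
    also have "[det (1\<^sub>m n - (graded 3 C3 + graded 4 C4))
        = det (1\<^sub>m n - graded 3 C3) * det (1\<^sub>m n - graded 4 C4)] (mod monom 1 5)"
      using carr C4
      by (intro det_one_minus_add_cong)
        (auto simp: graded_mult[of _ n n _ n] monom_1_dvd_iff' simp del: index_mult_mat(1))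
    then have "[det (1\<^sub>m n - graded 2 C2) * det (1\<^sub>m n - (graded 3 C3 + graded 4 C4))
        = det (1\<^sub>m n - graded 2 C2) * (det (1\<^sub>m n - graded 3 C3) * det (1\<^sub>m n - graded 4 C4))]
        (mod monom 1 5)"
      by (intro cong_mult cong_refl)
    finally show "[det (1\<^sub>m n - N) = det (1\<^sub>m n - graded 2 C2) *
      (det (1\<^sub>m n - graded 3 C3) * det (1\<^sub>m n - graded 4 C4))] (mod monom 1 5)" .
  qed
  finally show ?thesis
    using A B by (simp add: P_def Q_def graded_add)
qed

theorem mainTheorem6:
  fixes A B :: "'a :: field mat" and n :: nat
  assumes "0 < n" and "A \<in> carrier_mat n n" and "B \<in> carrier_mat n n"
  shows "S 4 (A + B) =
      S 4 A + S 4 B - S 1 ((A ^\<^sub>m 3) * B) - S 1 ((A ^\<^sub>m 2) * (B ^\<^sub>m 2)) - S 1 (A * (B ^\<^sub>m 3))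
    + S 1 ((A ^\<^sub>m 2) * B) * S 1 A + S 1 ((A ^\<^sub>m 2) * B) * S 1 B
    + S 1 (A * (B ^\<^sub>m 2)) * S 1 A + S 1 (A * (B ^\<^sub>m 2)) * S 1 B
    - S 1 (A * B) * S 1 A * S 1 B + S 3 A * S 1 B + S 3 B * S 1 A + S 2 A * S 2 B
    - S 2 A * S 1 (A * B) - S 2 B * S 1 (A * B) + S 2 (A * B)"
proof -
  note A = assms(2) and B = assms(3)
  have pows: "A ^\<^sub>m 2 = A * A" "B ^\<^sub>m 2 = B * B" "A ^\<^sub>m 3 = A * (A * A)" "B ^\<^sub>m 3 = B * (B * B)"
    using A B by (simp_all add: numeral_2_eq_2 numeral_3_eq_3)
  define C2 C3 C4 where "C2 = A * B" and "C3 = A ^\<^sub>m 2 * B + A * B ^\<^sub>m 2"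
    and "C4 = A ^\<^sub>m 3 * B + (A ^\<^sub>m 2 * B ^\<^sub>m 2 + A * B ^\<^sub>m 3)"
  have carr: "C2 \<in> carrier_mat n n" "C3 \<in> carrier_mat n n" "C4 \<in> carrier_mat n n"
    using A B by (simp_all add: C2_def C3_def C4_def pows)
  have C3: "C3 = A * C2 + C2 * B"
    using A B by (simp add: C2_def C3_def pows assoc_mult_mat[of _ n n _ n _ n])
  have C4: "C4 + A * C2 * B = A * C3 + C3 * B"
    using A B by (simp add: C2_def C3_def C4_def pows assoc_mult_mat[of _ n n _ n _ n]
        mult_add_distrib_mat[of _ n n _ n] add_mult_distrib_mat[of _ n n _ _ n])
      (intro eq_matI; simp add: algebra_simps del: index_mult_mat(1))
  define a b c2 c3 c4 where "a = det (1\<^sub>m n - graded 1 A)" and "b = det (1\<^sub>m n - graded 1 B)"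
    and "c2 = det (1\<^sub>m n - graded 2 C2)" and "c3 = det (1\<^sub>m n - graded 3 C3)"
    and "c4 = det (1\<^sub>m n - graded 4 C4)"
  note defs = a_def b_def c2_def c3_def c4_def
  note coeffs = coeff_det_one_minus_graded[of _ n] S_0[of _ n]
  \<comment> \<open>Convolutions written out, so that products of opaque polynomials are evaluated from their
    lowest five coefficients only.\<close>
  have coeff_mult_le_4:
    "coeff (p * q) 0 = coeff p 0 * coeff q 0"
    "coeff (p * q) 1 = coeff p 0 * coeff q 1 + coeff p 1 * coeff q 0"
    "coeff (p * q) 2 = coeff p 0 * coeff q 2 + coeff p 1 * coeff q 1 + coeff p 2 * coeff q 0"
    "coeff (p * q) 3 = coeff p 0 * coeff q 3 + coeff p 1 * coeff q 2 + coeff p 2 * coeff q 1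
      + coeff p 3 * coeff q 0"
    "coeff (p * q) 4 = coeff p 0 * coeff q 4 + coeff p 1 * coeff q 3 + coeff p 2 * coeff q 2
      + coeff p 3 * coeff q 1 + coeff p 4 * coeff q 0" for p q :: "'a poly"
    by (simp_all add: coeff_mult numeral_eq_Suc)
  have coeffs_1:
    "coeff a 0 = 1" "coeff a 1 = - S 1 A" "coeff a 2 = S 2 A" "coeff a 3 = - S 3 A" "coeff a 4 = S 4 A"
    "coeff b 0 = 1" "coeff b 1 = - S 1 B" "coeff b 2 = S 2 B" "coeff b 3 = - S 3 B" "coeff b 4 = S 4 B"
    using A B by (simp_all add: a_def b_def coeffs)
  have coeffs_2:
    "coeff c2 0 = 1" "coeff c2 1 = 0" "coeff c2 2 = - S 1 C2" "coeff c2 3 = 0" "coeff c2 4 = S 2 C2"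
    "coeff c3 0 = 1" "coeff c3 1 = 0" "coeff c3 2 = 0" "coeff c3 3 = - S 1 C3" "coeff c3 4 = 0"
    "coeff c4 0 = 1" "coeff c4 1 = 0" "coeff c4 2 = 0" "coeff c4 3 = 0" "coeff c4 4 = - S 1 C4"
    using carr by (simp_all add: c2_def c3_def c4_def coeffs)
  have "S 4 (A + B) = coeff (det (1\<^sub>m n - graded 1 (A + B))) 4"
    using A B by (simp add: coeffs)
  also have "\<dots> = coeff (a * (c2 * (c3 * c4)) * b) 4"
    using det_truncated_factorization[OF A B C2_def C3 carr(3) C4]
    unfolding cong_monom_iff defs by simp
  also have "\<dots> = S 4 A + S 4 B + S 3 A * S 1 B + S 3 B * S 1 A + S 2 A * S 2 B
      - (S 2 A + S 1 A * S 1 B + S 2 B) * S 1 C2 + (S 1 A + S 1 B) * S 1 C3 + S 2 C2 - S 1 C4"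
    unfolding coeff_mult_le_4 coeffs_1 coeffs_2 by (simp add: algebra_simps)
  also have "S 1 C3 = S 1 (A ^\<^sub>m 2 * B) + S 1 (A * B ^\<^sub>m 2)"
    unfolding C3_def using A B by (intro S_1_add) (auto simp: pows)
  also have "S 1 C4 = S 1 (A ^\<^sub>m 3 * B) + S 1 (A ^\<^sub>m 2 * B ^\<^sub>m 2 + A * B ^\<^sub>m 3)"
    unfolding C4_def using A B by (intro S_1_add) (auto simp: pows)
  also have "S 1 (A ^\<^sub>m 2 * B ^\<^sub>m 2 + A * B ^\<^sub>m 3)
      = S 1 (A ^\<^sub>m 2 * B ^\<^sub>m 2) + S 1 (A * B ^\<^sub>m 3)"
    using A B by (intro S_1_add) (auto simp: pows)
  finally show ?thesis
    unfolding C2_def by (simp add: algebra_simps)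
qed

end
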